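(* Let $\mu:\mathcal{C}\to\mathbb{R}_0^+$ and $\nu:\mathcal{E}\to\mathbb{R}_0^+$ be set functions with $\mu(\emptyset)=\nu(\emptyset)=0$, and let $f:S\to\mathbb{R}_0^+$ be $\mu$-measurable. If $A\in\mathcal{C}$ is such that $f\in G_{RL}(\nu,\mu,A)$, then for every $a,b>0$, $f\in G_{RL}(a\nu,b\mu,A)$ and $$\int_A^{*} f\,d(a\nu,b\mu)=ab\cdot\int_A^{*} f\,d(\nu,\mu).$$
   Context: $\mathbb{R}_0^+=[0,\infty)$. $S$ is a nonempty, at least countable set, $\mathcal{C}$ is a $\sigma$-algebra of subsets of $S$, and $\mathcal{E}$ is a $\sigma$-algebra of subsets of $\mathbb{R}_0^+$ with $\{0\}\in\mathcal{E}$. Set functions on $\mathcal{C}$ and $\mathcal{E}$ have values in $\mathbb{R}_0^+$, vanish on $\emptyset$, and are not assumed additive or monotone unless stated. Measurability: $f:S\to\mathbb{R}_0^+$ is $\mu$-measurable if it is $\mathcal{C}$-measurable, i.e. $E_f^\alpha:=\{s\in S: f(s)\ge\alpha\}\in\mathcal{C}$ for all $\alpha\ge 0$. Riemann-Lebesgue (RL) integral: for two countable partitions $P,P'$ of $\mathbb{R}_0^+$, $P'$ is finer than $P$ if every set of $P'$ is included in some set of $P$. A function $g:\mathbb{R}_0^+\to\mathbb{R}$ is $\nu$-RL integrable if there is $c\in\mathbb{R}$ such that for every $\varepsilon>0$ there is a countable partition $\Pi_\varepsilon$ of $\mathbb{R}_0^+$ into sets of $\mathcal{E}$ such that for every countable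 partition $\Pi=(E_n)_n$ of $\mathbb{R}_0^+$ into sets of $\mathcal{E}$ finer than $\Pi_\varepsilon$: $g$ is bounded on every $E_n$ with $\nu(E_n)>0$, and for every choice of $s_n\in E_n$ the series $\sum_n g(s_n)\nu(E_n)$ converges absolutely and $|\sum_n g(s_n)\nu(E_n)-c|<\varepsilon$. Then $c$ is unique and is denoted $(RL)\int_{[0,\infty)}g\,d\nu$. Generalized decomposition integral: for a $\mu$-measurable $f:S\to\mathbb{R}_0^+$ and $A\in\mathcal{C}$ put $u_{f,\mu}^{A}(\alpha)=\mu(E_f^\alpha\cap A)$, $\alpha\ge 0$. $f$ is $(\nu,\mu)$-integrable on $A$ if $u_{f,\mu}^A$ is $\nu$-RL integrable on $\mathbb{R}_0^+$, and then $\int_A^{*}f\,d(\nu,\mu):=(RL)\int_{[0,\infty)}u_{f,\mu}^A\,d\nu$. $G_{RL}(\nu,\mu,A)$ is the set of all $\mu$-measurable $f:S\to\mathbb{R}_0^+$ that are $(\nu,\mu)$-integrable on $A$ (with finite integral). *)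

theory Defs
  imports "HOL-Analysis.Analysis"
begin

text \<open>``Countable'' means at most countable, so finite partitions are allowed, and by
  \<^const>\<open>partition_on\<close> the members are nonempty. A partition is an unordered family; this suffices
  because the sums below are required to converge absolutely.\<close>

definition countable_partition :: "real set set \<Rightarrow> real set set \<Rightarrow> bool" where
  "countable_partition \<E> P \<longleftrightarrow> countable P \<and> P \<subseteq> \<E> \<and> partition_on {0..} P"

definition has_RL_integral ::
  "real set set \<Rightarrow> (real set \<Rightarrow> real) \<Rightarrow> (real \<Rightarrow> real) \<Rightarrow> real \<Rightarrow> bool" where
  "has_RL_integral \<E> \<nu> g c \<longleftrightarrow>
     (\<forall>\<epsilon>>0. \<exists>P\<epsilon>. countable_partition \<E> P\<epsilon> \<and>
        (\<forall>P. countable_partition \<E> P \<and> refines {0..} P P\<epsilon> \<longrightarrow>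
           (\<forall>X\<in>P. \<nu> X > 0 \<longrightarrow> bounded (g ` X)) \<and>
           (\<forall>s. (\<forall>X\<in>P. s X \<in> X) \<longrightarrow>
              (\<lambda>X. \<bar>g (s X) * \<nu> X\<bar>) summable_on P \<and>
              \<bar>(\<Sum>\<^sub>\<infinity>X\<in>P. g (s X) * \<nu> X) - c\<bar> < \<epsilon>)))"

definition RL_integrable ::
  "real set set \<Rightarrow> (real set \<Rightarrow> real) \<Rightarrow> (real \<Rightarrow> real) \<Rightarrow> bool" where
  "RL_integrable \<E> \<nu> g \<longleftrightarrow> (\<exists>c. has_RL_integral \<E> \<nu> g c)"

definition RL_integral ::
  "real set set \<Rightarrow> (real set \<Rightarrow> real) \<Rightarrow> (real \<Rightarrow> real) \<Rightarrow> real" where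
  "RL_integral \<E> \<nu> g = (THE c. has_RL_integral \<E> \<nu> g c)"

text \<open>Uniqueness of the value, which makes the description in \<^const>\<open>RL_integral\<close> legitimate.\<close>

lemma countable_partition_common_refinement:
  assumes \<E>: "sigma_algebra {0..} \<E>"
    and P: "countable_partition \<E> P" and Q: "countable_partition \<E> Q"
  obtains R where "countable_partition \<E> R" "refines {0..} R P" "refines {0..} R Q"
proof -
  interpret sigma_algebra "{0..}" \<E> by (rule \<E>)
  define R where "R = (\<lambda>(X, Y). X \<inter> Y) ` (P \<times> Q) - {{}}"
  have "countable R"
    unfolding R_def using P Q by (auto simp: countable_partition_def)
  moreover have "R \<subseteq> \<E>"
    unfolding R_def using P Q by (auto simp: countable_partition_def subset_iff)
  moreover have part: "partition_on {0..} R"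
  proof (rule partition_onI)
    have "\<Union>P = {0..}" "\<Union>Q = {0..}"
      using P Q by (auto simp: countable_partition_def partition_on_def)
    moreover have "\<Union>R = \<Union>P \<inter> \<Union>Q"
      unfolding R_def by auto
    ultimately show "\<Union>R = {0..}" by simp
    have dP: "X = X'" if "X \<in> P" "X' \<in> P" "x \<in> X" "x \<in> X'" for X X' x
      using P that unfolding countable_partition_def partition_on_def disjoint_def by blast
    have dQ: "X = X'" if "X \<in> Q" "X' \<in> Q" "x \<in> X" "x \<in> X'" for X X' x
      using Q that unfolding countable_partition_def partition_on_def disjoint_def by blast
    show "disjnt p q" if "p \<in> R" "q \<in> R" "p \<noteq> q" for p q
      using that dP dQ unfolding R_def disjnt_iff by (clarsimp) metis
    show "{} \<notin> R" by (auto simp: R_def)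
  qed
  ultimately have "countable_partition \<E> R"
    by (simp add: countable_partition_def)
  moreover have "refines {0..} R P" "refines {0..} R Q"
    using part P Q unfolding refines_def countable_partition_def R_def by auto
  ultimately show thesis by (rule that)
qed

lemma has_RL_integral_unique:
  assumes \<E>: "sigma_algebra {0..} \<E>"
    and c: "has_RL_integral \<E> \<nu> g c" and d: "has_RL_integral \<E> \<nu> g d"
  shows "c = d"
proof (rule ccontr)
  assume "c \<noteq> d"
  define e where "e = \<bar>c - d\<bar> / 2"
  have e: "e > 0" using \<open>c \<noteq> d\<close> by (simp add: e_def)
  obtain P where P: "countable_partition \<E> P"
    and Pc: "\<And>R s. countable_partition \<E> R \<Longrightarrow> refines {0..} R P \<Longrightarrow> \<forall>X\<in>R. s X \<in> X \<Longrightarrow>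
      \<bar>(\<Sum>\<^sub>\<infinity>X\<in>R. g (s X) * \<nu> X) - c\<bar> < e"
    using c e unfolding has_RL_integral_def by metis
  obtain Q where Q: "countable_partition \<E> Q"
    and Qd: "\<And>R s. countable_partition \<E> R \<Longrightarrow> refines {0..} R Q \<Longrightarrow> \<forall>X\<in>R. s X \<in> X \<Longrightarrow>
      \<bar>(\<Sum>\<^sub>\<infinity>X\<in>R. g (s X) * \<nu> X) - d\<bar> < e"
    using d e unfolding has_RL_integral_def by metis
  obtain R where R: "countable_partition \<E> R" "refines {0..} R P" "refines {0..} R Q"
    using countable_partition_common_refinement[OF \<E> P Q] .
  have "\<forall>X\<in>R. \<exists>x. x \<in> X"
    using R(1) unfolding countable_partition_def partition_on_def by (metis ex_in_conv)
  then obtain s where s: "\<forall>X\<in>R. s X \<in> X" by metis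
  have "\<not> (\<bar>t - c\<bar> < e \<and> \<bar>t - d\<bar> < e)" for t
    unfolding e_def by (simp add: abs_if split: if_splits)
  then show False
    using Pc[OF R(1,2) s] Qd[OF R(1,3) s] by blast
qed

lemma RL_integral_eq:
  assumes "sigma_algebra {0..} \<E>" and "has_RL_integral \<E> \<nu> g c"
  shows "RL_integral \<E> \<nu> g = c"
  unfolding RL_integral_def using assms has_RL_integral_unique by blast

definition upper_level_set :: "'a set \<Rightarrow> ('a \<Rightarrow> real) \<Rightarrow> real \<Rightarrow> 'a set" where
  "upper_level_set S f \<alpha> = {s \<in> S. f s \<ge> \<alpha>}"

definition level_measurable :: "'a set \<Rightarrow> 'a set set \<Rightarrow> ('a \<Rightarrow> real) \<Rightarrow> bool" where
  "level_measurable S \<C> f \<longleftrightarrow> (\<forall>\<alpha>\<ge>0. upper_level_set S f \<alpha> \<in> \<C>)"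

definition level_function ::
  "'a set \<Rightarrow> ('a set \<Rightarrow> real) \<Rightarrow> ('a \<Rightarrow> real) \<Rightarrow> 'a set \<Rightarrow> real \<Rightarrow> real" where
  "level_function S \<mu> f A = (\<lambda>\<alpha>. \<mu> (upper_level_set S f \<alpha> \<inter> A))"

definition decomp_integrable ::
  "'a set \<Rightarrow> real set set \<Rightarrow> (real set \<Rightarrow> real) \<Rightarrow> ('a set \<Rightarrow> real) \<Rightarrow> 'a set \<Rightarrow> ('a \<Rightarrow> real) \<Rightarrow> bool"
  where
  "decomp_integrable S \<E> \<nu> \<mu> A f \<longleftrightarrow> RL_integrable \<E> \<nu> (level_function S \<mu> f A)"

definition decomp_integral ::
  "'a set \<Rightarrow> real set set \<Rightarrow> (real set \<Rightarrow> real) \<Rightarrow> ('a set \<Rightarrow> real) \<Rightarrow> 'a set \<Rightarrow> ('a \<Rightarrow> real) \<Rightarrow> real"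
  where
  "decomp_integral S \<E> \<nu> \<mu> A f = RL_integral \<E> \<nu> (level_function S \<mu> f A)"

text \<open>Functions on \<open>S\<close> are total functions whose values outside \<open>S\<close> are irrelevant.\<close>

definition G_RL ::
  "'a set \<Rightarrow> 'a set set \<Rightarrow> real set set \<Rightarrow> (real set \<Rightarrow> real) \<Rightarrow> ('a set \<Rightarrow> real) \<Rightarrow> 'a set \<Rightarrow>
     ('a \<Rightarrow> real) set" where
  "G_RL S \<C> \<E> \<nu> \<mu> A =
     {f. f \<in> S \<rightarrow> {0..} \<and> level_measurable S \<C> f \<and> decomp_integrable S \<E> \<nu> \<mu> A f}"

end

theory Submission
  imports Defs
begin

text \<open>Scaling \<open>\<mu>\<close> by \<open>b\<close> multiplies the level function by
  \<open>b\<close> pointwise, and scaling \<open>\<nu>\<close> by \<open>a\<close> multiplies every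
  weight by \<open>a\<close>. Hence each Riemann-Lebesgue sum over a tagged partition is multiplied
  by exactly \<open>a * b\<close>, and a partition that controls the original sums to within a
  smaller tolerance also controls the scaled ones. This is \<open>has_RL_integral_scale\<close>,
  which uses no additivity or monotonicity of the set functions. Uniqueness of the RL value
  (\<open>RL_integral_eq\<close>) then turns the statement about limits into the equation between
  integrals.\<close>

lemma has_RL_integral_scale:
  fixes a b :: real
  assumes "has_RL_integral \<E> \<nu> g c" and "a \<ge> 0"
  shows "has_RL_integral \<E> (\<lambda>X. a * \<nu> X) (\<lambda>x. b * g x) (a * b * c)"
  unfolding has_RL_integral_def
proof (intro allI impI)
  fix \<epsilon> :: real assume "\<epsilon> > 0"
  \<comment> \<open>The added 1 keeps \<open>\<epsilon> / K\<close> meaningful when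
    \<open>a * b = 0\<close>, a case the lemma admits: \<open>a\<close> may vanish and
    \<open>b\<close> is arbitrary.\<close>
  define K where "K = \<bar>a * b\<bar> + 1"
  have K: "K > 0" "\<bar>a * b\<bar> \<le> K" by (auto simp: K_def)
  with \<open>\<epsilon> > 0\<close> have "\<epsilon> / K > 0" by simp
  with assms(1) obtain P\<^sub>0 where P\<^sub>0: "countable_partition \<E> P\<^sub>0"
    and fine: "\<forall>P. countable_partition \<E> P \<and> refines {0..} P P\<^sub>0 \<longrightarrow>
      (\<forall>X\<in>P. \<nu> X > 0 \<longrightarrow> bounded (g ` X)) \<and>
      (\<forall>s. (\<forall>X\<in>P. s X \<in> X) \<longrightarrow>
        (\<lambda>X. \<bar>g (s X) * \<nu> X\<bar>) summable_on P \<and>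
        \<bar>(\<Sum>\<^sub>\<infinity>X\<in>P. g (s X) * \<nu> X) - c\<bar> < \<epsilon> / K)"
    unfolding has_RL_integral_def by blast
  show "\<exists>P\<epsilon>. countable_partition \<E> P\<epsilon> \<and>
        (\<forall>P. countable_partition \<E> P \<and> refines {0..} P P\<epsilon> \<longrightarrow>
           (\<forall>X\<in>P. a * \<nu> X > 0 \<longrightarrow> bounded ((\<lambda>x. b * g x) ` X)) \<and>
           (\<forall>s. (\<forall>X\<in>P. s X \<in> X) \<longrightarrow>
              (\<lambda>X. \<bar>b * g (s X) * (a * \<nu> X)\<bar>) summable_on P \<and>
              \<bar>(\<Sum>\<^sub>\<infinity>X\<in>P. b * g (s X) * (a * \<nu> X)) - a * b * c\<bar> < \<epsilon>))"
  proof (intro exI[of _ P\<^sub>0] conjI allI impI ballI P\<^sub>0; elim conjE)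
    fix P X assume P: "countable_partition \<E> P" "refines {0..} P P\<^sub>0" "X \<in> P" "a * \<nu> X > 0"
    \<comment> \<open>The sign of \<open>a\<close> matters here: a set of positive scaled weight
      must already have positive weight under \<open>\<nu>\<close>, since \<open>g\<close> is known
      to be bounded only on such sets.\<close>
    then have "\<nu> X > 0" using \<open>a \<ge> 0\<close> by (simp add: zero_less_mult_iff)
    then have "bounded ((\<lambda>y. b *\<^sub>R y) ` g ` X)"
      using fine P by (intro bounded_scaling) blast
    then show "bounded ((\<lambda>x. b * g x) ` X)" by (simp add: image_image)
  next
    fix P s assume P: "countable_partition \<E> P" "refines {0..} P P\<^sub>0" "\<forall>X\<in>P. s X \<in> X"
    let ?t = "\<Sum>\<^sub>\<infinity>X\<in>P. g (s X) * \<nu> X"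
    have summ: "(\<lambda>X. \<bar>g (s X) * \<nu> X\<bar>) summable_on P" and close: "\<bar>?t - c\<bar> < \<epsilon> / K"
      using fine P by blast+
    \<comment> \<open>Collecting both factors in front lets absolute summability, the sum and its
      error all scale by one constant.\<close>
    have scale: "b * g (s X) * (a * \<nu> X) = a * b * (g (s X) * \<nu> X)" for X by simp
    show "(\<lambda>X. \<bar>b * g (s X) * (a * \<nu> X)\<bar>) summable_on P"
      unfolding scale abs_mult[of "a * b"] by (intro summable_on_cmult_right summ)
    have "\<bar>(\<Sum>\<^sub>\<infinity>X\<in>P. b * g (s X) * (a * \<nu> X)) - a * b * c\<bar> = \<bar>a * b\<bar> * \<bar>?t - c\<bar>"
      unfolding scale infsum_cmult_right' right_diff_distrib[symmetric] abs_mult[of "a * b"] ..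
    also have "\<dots> \<le> K * \<bar>?t - c\<bar>" using K by (intro mult_right_mono) auto
    also have "\<dots> < \<epsilon>" using close K by (simp add: field_simps)
    finally show "\<bar>(\<Sum>\<^sub>\<infinity>X\<in>P. b * g (s X) * (a * \<nu> X)) - a * b * c\<bar> < \<epsilon>" .
  qed
qed

theorem proposition3p15:
  fixes S :: "'a set" and \<C> :: "'a set set" and \<E> :: "real set set"
    and \<mu> :: "'a set \<Rightarrow> real" and \<nu> :: "real set \<Rightarrow> real"
    and f :: "'a \<Rightarrow> real" and A :: "'a set"
  assumes "S \<noteq> {}" and "infinite S"
    and "sigma_algebra S \<C>"
    and "sigma_algebra {0..} \<E>" and "{0} \<in> \<E>"
    and "\<mu> \<in> \<C> \<rightarrow> {0..}" and "\<mu> {} = 0"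
    and "\<nu> \<in> \<E> \<rightarrow> {0..}" and "\<nu> {} = 0"
    and "f \<in> S \<rightarrow> {0..}" and "level_measurable S \<C> f"
    and "A \<in> \<C>" and "f \<in> G_RL S \<C> \<E> \<nu> \<mu> A"
  shows "\<forall>a>0. \<forall>b>0.
      f \<in> G_RL S \<C> \<E> (\<lambda>X. a * \<nu> X) (\<lambda>B. b * \<mu> B) A \<and>
      decomp_integral S \<E> (\<lambda>X. a * \<nu> X) (\<lambda>B. b * \<mu> B) A f =
        a * b * decomp_integral S \<E> \<nu> \<mu> A f"
proof (intro allI impI)
  fix a b :: real assume "a > 0" "b > 0"
  obtain c where c: "has_RL_integral \<E> \<nu> (level_function S \<mu> f A) c"
    using assms(13) by (auto simp: G_RL_def decomp_integrable_def RL_integrable_def)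
  have "has_RL_integral \<E> (\<lambda>X. a * \<nu> X) (level_function S (\<lambda>B. b * \<mu> B) f A) (a * b * c)"
    using has_RL_integral_scale[OF c, of a b] \<open>a > 0\<close> by (simp add: level_function_def)
  then show "f \<in> G_RL S \<C> \<E> (\<lambda>X. a * \<nu> X) (\<lambda>B. b * \<mu> B) A \<and>
      decomp_integral S \<E> (\<lambda>X. a * \<nu> X) (\<lambda>B. b * \<mu> B) A f =
        a * b * decomp_integral S \<E> \<nu> \<mu> A f"
    \<comment> \<open>\<open>RL_integral_eq\<close> is applied twice, evaluating the original
      integral as \<open>c\<close> and the scaled one as \<open>a * b * c\<close>. Measurability of
      \<open>f\<close> involves neither set function, so it carries over unchanged.\<close>
    using assms(10,11) c RL_integral_eq[OF assms(4)]
    by (auto simp: G_RL_def decomp_integrable_def RL_integrable_def decomp_integral_def)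
qed

end
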